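(* Let $E,F$ be Banach spaces and suppose that $T_0\in B^+(E,F)$ with $R(T_0)\oplus N=F$, that $F=F_*\oplus N$, and that $\dim N>0$. Then $T_0$ and $P_{F_*}^{N}T_0$ are path connected in the set $$S=\{T\in B^+(E,F) : F=R(T)\oplus N \text{ and } N(T)=N(T_0)\}.$$
   Context: $B(E,F)$ denotes the set of all bounded linear operators from $E$ to $F$ with the operator norm; $R(T)$ and $N(T)$ denote the range and kernel of $T$ (the letter $N$ alone denotes the given subspace of $F$). $B^+(E,F)$ denotes the set of double splitting operators in $B(E,F)$, i.e. those $T$ whose kernel $N(T)$ is a closed complemented subspace of $E$ and whose range $R(T)$ is a closed complemented subspace of $F$. Decompositions $A\oplus B$ are topological direct sums of closed subspaces, and $P_A^B$ denotes the bounded projection onto $A$ with kernel $B$. Two operators $T_0,T_1$ in a set $S\subset B(E,F)$ are said to be path connected in $S$ if there is a (norm-continuous) path $\omega(t)\in S$, $t\in[0,1]$, with $\omega(0)=T_0$ and $\omega(1)=T_1$. *)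

theory Defs
  imports "HOL-Analysis.Analysis"
begin

(* A Banach space over a scalar field 'k that may be the reals, the complex numbers, or any
   other real normed field.  The class banach only provides real scalars; scale is the
   multiplication by 'k, which has to extend the real one and be compatible with the norm. *)
locale banach_over = vector_space scale
  for scale :: "'k::real_normed_field \<Rightarrow> 'a::banach \<Rightarrow> 'a" +
  assumes scale_of_real: "scale (of_real r) x = r *\<^sub>R x"
    and norm_scale: "norm (scale c x) = norm c * norm x"

lemma banach_over_real: "banach_over ((*\<^sub>R) :: real \<Rightarrow> 'a::banach \<Rightarrow> 'a)"
  by unfold_locales (simp_all add: algebra_simps)

lemma banach_over_complex: "banach_over ((*) :: complex \<Rightarrow> complex \<Rightarrow> complex)"
  by unfold_locales (simp_all add: algebra_simps norm_mult scaleR_conv_of_real)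

(* B(E,F).  The operator norm does not depend on the scalar field, so B(E,F) is the set of
   those elements of the real operator space that are 'k-linear. *)
definition bounded_ops ::
    "('k::real_normed_field \<Rightarrow> 'a::banach \<Rightarrow> 'a) \<Rightarrow> ('k \<Rightarrow> 'b::banach \<Rightarrow> 'b) \<Rightarrow> ('a \<Rightarrow>\<^sub>L 'b) set"
  where "bounded_ops sE sF = {T. Vector_Spaces.linear sE sF (blinfun_apply T)}"

definition op_kernel :: "('a::real_normed_vector \<Rightarrow>\<^sub>L 'b::real_normed_vector) \<Rightarrow> 'a set"
  where "op_kernel T = {x. blinfun_apply T x = 0}"

definition op_range :: "('a::real_normed_vector \<Rightarrow>\<^sub>L 'b::real_normed_vector) \<Rightarrow> 'b set"
  where "op_range T = range (blinfun_apply T)"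

(* The whole space is the topological direct sum of A and B: bijectivity of the addition map
   A x B \<rightarrow> UNIV is the unique decomposition, continuity of its inverse makes the sum
   topological. *)
definition topological_direct_sum ::
    "('k::real_normed_field \<Rightarrow> 'a::banach \<Rightarrow> 'a) \<Rightarrow> 'a set \<Rightarrow> 'a set \<Rightarrow> bool"
  where "topological_direct_sum s A B \<longleftrightarrow>
    module.subspace s A \<and> closed A \<and> module.subspace s B \<and> closed B \<and>
    (\<exists>g. homeomorphism (A \<times> B) UNIV (\<lambda>(a, b). a + b) g)"

definition closed_complemented ::
    "('k::real_normed_field \<Rightarrow> 'a::banach \<Rightarrow> 'a) \<Rightarrow> 'a set \<Rightarrow> bool"
  where "closed_complemented s A \<longleftrightarrow> (\<exists>B. topological_direct_sum s A B)"

definition double_splitting ::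
    "('k::real_normed_field \<Rightarrow> 'a::banach \<Rightarrow> 'a) \<Rightarrow> ('k \<Rightarrow> 'b::banach \<Rightarrow> 'b) \<Rightarrow> ('a \<Rightarrow>\<^sub>L 'b) set"
  where "double_splitting sE sF = {T \<in> bounded_ops sE sF.
    closed_complemented sE (op_kernel T) \<and> closed_complemented sF (op_range T)}"

(* The projection onto A with kernel B; meaningful only if the space is the topological direct
   sum of A and B, in which case it exists, is unique, and is linear over the same scalars as
   the subspaces A and B. *)
definition proj_along :: "'a::banach set \<Rightarrow> 'a set \<Rightarrow> 'a \<Rightarrow>\<^sub>L 'a"
  where "proj_along A B = (THE P. P o\<^sub>L P = P \<and> op_range P = A \<and> op_kernel P = B)"

end

theory Submission
  imports Defs
begin

text \<open>
  Two bounded projections \<open>R\<close> and \<open>P\<close> along the same closed subspace \<open>N\<close> absorb each other from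
  the right, \<open>R P = R\<close> and \<open>P R = P\<close>, because \<open>x - R x\<close> and \<open>x - P x\<close> lie in \<open>N\<close>.  Multiplying out
  therefore shows that \<open>P\<^sub>t = (1 - t) R + t P\<close> is again a projection along \<open>N\<close> for every real \<open>t\<close>:
  the projections along \<open>N\<close> form an affine space (\<open>projection_onto_along_affine\<close>).

  Now let \<open>R\<close> project onto the range of \<open>T\<^sub>0\<close> and \<open>P\<close> onto \<open>F'\<close>, both along \<open>N\<close>.  Since
  \<open>R T\<^sub>0 = T\<^sub>0\<close>, the straight segment from \<open>T\<^sub>0\<close> to \<open>P T\<^sub>0\<close> is \<open>t \<mapsto> P\<^sub>t T\<^sub>0\<close>.  The range of \<open>P\<^sub>t T\<^sub>0\<close>
  is the image under \<open>P\<^sub>t\<close> of a complement of its kernel \<open>N\<close>, hence the whole range of \<open>P\<^sub>t\<close>, which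
  is complementary to \<open>N\<close>; and its kernel is that of \<open>T\<^sub>0\<close>, since the range of \<open>T\<^sub>0\<close> meets \<open>N\<close>
  only in \<open>0\<close> (\<open>projection_comp_range_kernel\<close>).  So the segment never leaves the set in question.

  What remains is the translation between topological direct sums and bounded projections
  (\<open>projection_imp_topological_direct_sum\<close>, \<open>topological_direct_sum_imp_projection\<close>).
\<close>

definition projection_onto_along ::
    "('k::real_normed_field \<Rightarrow> 'a::banach \<Rightarrow> 'a) \<Rightarrow> 'a set \<Rightarrow> 'a set \<Rightarrow> ('a \<Rightarrow>\<^sub>L 'a) \<Rightarrow> bool"
  where "projection_onto_along s A B P \<longleftrightarrow>
    P \<in> bounded_ops s s \<and> P o\<^sub>L P = P \<and> op_range P = A \<and> op_kernel P = B"

lemma projection_apply: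
  assumes "projection_onto_along s A B P"
  shows projection_in: "P x \<in> A"
    and projection_fixes: "a \<in> A \<Longrightarrow> P a = a"
    and projection_eq_0_iff: "P x = 0 \<longleftrightarrow> x \<in> B"
proof -
  have idem: "P (P y) = P y" for y
    using assms unfolding projection_onto_along_def by (metis blinfun_apply_blinfun_compose)
  show "P x \<in> A" "a \<in> A \<Longrightarrow> P a = a" "P x = 0 \<longleftrightarrow> x \<in> B"
    using assms idem by (auto simp: projection_onto_along_def op_range_def op_kernel_def)
qed

lemma bounded_ops_iff:
  assumes "banach_over s1" "banach_over s2"
  shows "T \<in> bounded_ops s1 s2 \<longleftrightarrow> (\<forall>c x. T (s1 c x) = s2 c (T x))"
  using assms
  by (auto simp: bounded_ops_def banach_over_def Vector_Spaces.linear_iff blinfun.add_right)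

lemma bounded_ops_compose:
  assumes "banach_over s1" "banach_over s2" "banach_over s3"
    and "S \<in> bounded_ops s2 s3" "T \<in> bounded_ops s1 s2"
  shows "S o\<^sub>L T \<in> bounded_ops s1 s3"
  using assms by (simp add: bounded_ops_iff)

lemma bounded_ops_affine:
  assumes "banach_over s1" "banach_over s2"
    and "S \<in> bounded_ops s1 s2" "T \<in> bounded_ops s1 s2"
  shows "(1 - t) *\<^sub>R S + t *\<^sub>R T \<in> bounded_ops s1 s2"
proof -
  interpret banach_over s2 by fact
  have "s2 c (r *\<^sub>R x) = r *\<^sub>R s2 c x" for c r x
    by (metis scale_left_commute scale_of_real)
  then show ?thesis
    using assms by (simp add: bounded_ops_iff blinfun.add_left blinfun.scaleR_left scale_right_distrib)
qed

lemma projection_imp_topological_direct_sum: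
  assumes s: "banach_over s" and P: "projection_onto_along s A B P"
  shows "topological_direct_sum s A B"
proof -
  interpret banach_over s by fact
  have idem [simp]: "P (P x) = P x" for x
    using projection_fixes[OF P projection_in[OF P]] .
  have lin: "P (s c x) = s c (P x)" for c x
    using P s by (simp add: projection_onto_along_def bounded_ops_iff)
  have B: "B = {x. P x = 0}"
    using projection_eq_0_iff[OF P] by auto
  have A: "A = {x. P x = x}"
    by (auto dest: projection_fixes[OF P]) (metis projection_in[OF P])
  have "subspace A" "subspace B"
    unfolding A B by (auto simp: subspace_def lin blinfun.add_right)
  moreover have "closed A" "closed B"
    unfolding A B by (intro closed_Collect_eq continuous_intros)+
  moreover have "homeomorphism (A \<times> B) UNIV (\<lambda>(a, b). a + b) (\<lambda>x. (P x, x - P x))"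
    unfolding homeomorphism_def case_prod_beta
  proof (intro conjI ballI)
    show "(\<lambda>p. fst p + snd p) ` (A \<times> B) = UNIV"
    proof -
      have "x \<in> (\<lambda>p. fst p + snd p) ` (A \<times> B)" for x
        by (rule image_eqI[of _ _ "(P x, x - P x)"]) (auto simp: B blinfun.diff_right projection_in[OF P])
      then show ?thesis by auto
    qed
    show "range (\<lambda>x. (P x, x - P x)) = A \<times> B"
    proof -
      have "(a, b) \<in> range (\<lambda>x. (P x, x - P x))" if "a \<in> A" "b \<in> B" for a b
        using that by (intro image_eqI[of _ _ "a + b"]) (auto simp: B blinfun.add_right projection_fixes[OF P])
      then show ?thesis by (auto simp: B blinfun.diff_right projection_in[OF P])
    qed
  qed (auto simp: B blinfun.add_right projection_fixes[OF P] intro!: continuous_intros)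
  ultimately show ?thesis
    unfolding topological_direct_sum_def by blast
qed

lemma bounded_linear_if_continuous_at_0:
  fixes f :: "'a::real_normed_vector \<Rightarrow> 'b::real_normed_vector"
  assumes f: "Real_Vector_Spaces.linear f" and cont: "continuous (at 0) f"
  shows "bounded_linear f"
proof -
  have f0: "f 0 = 0"
    by (rule real_vector.linear_0[OF f])
  obtain d where d: "d > 0" "\<And>y. norm y < d \<Longrightarrow> norm (f y) < 1"
    using cont[unfolded continuous_at_eps_delta, rule_format, of 1]
    by (auto simp: f0 dist_norm)
  have "norm (f x) \<le> norm x * (2 / d)" for x
  proof (cases "x = 0")
    case False
    \<comment> \<open>rescale \<open>x\<close> to norm \<open>d / 2\<close>\<close>
    let ?c = "d / (2 * norm x)"
    have "norm (f (?c *\<^sub>R x)) < 1"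
      using False \<open>d > 0\<close> by (intro d(2)) simp
    then have "?c * norm (f x) < 1"
      using \<open>d > 0\<close> by (simp add: real_vector.linear_scale[OF f])
    then show ?thesis
      using False \<open>d > 0\<close> by (simp add: field_simps)
  qed (simp add: f0)
  then show ?thesis
    using f by (intro bounded_linear.intro bounded_linear_axioms.intro exI allI)
qed

text \<open>
  The projection is the first component of the inverse of the addition map.  Its linearity is the
  uniqueness of decompositions, and its boundedness is the continuity of that inverse.
\<close>

lemma topological_direct_sum_imp_projection:
  assumes s: "banach_over s" and AB: "topological_direct_sum s A B"
  obtains P where "projection_onto_along s A B P"
proof -
  interpret banach_over s by fact
  obtain g where sub: "subspace A" "subspace B"
    and g: "homeomorphism (A \<times> B) UNIV (\<lambda>(a, b). a + b) g"
    using AB by (auto simp: topological_direct_sum_def)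
  define p where "p x = fst (g x)" for x
  have g_add: "g (a + b) = (a, b)" if "a \<in> A" "b \<in> B" for a b
    using homeomorphism_apply1[OF g, of "(a, b)"] that by simp
  have p_add: "p (a + b) = a" if "a \<in> A" "b \<in> B" for a b
    using g_add[OF that] by (simp add: p_def)
  have "g x \<in> A \<times> B" for x
    using homeomorphism_image2[OF g] by blast
  moreover have "fst (g x) + snd (g x) = x" for x
    using homeomorphism_apply2[OF g, of x] by (simp add: case_prod_beta)
  ultimately have p: "p x \<in> A" "x - p x \<in> B" for x
    by (simp_all add: p_def mem_Times_iff) (metis add_diff_cancel_left')
  have plus: "p (x + y) = p x + p y" for x y
    using p_add[of "p x + p y" "(x - p x) + (y - p y)"] p sub by (simp add: subspace_add)
  have scale: "p (s c x) = s c (p x)" for c x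
    using p_add[of "s c (p x)" "s c (x - p x)"] p sub
    by (simp add: subspace_scale flip: scale_right_distrib)
  have "bounded_linear p"
  proof -
    have "Real_Vector_Spaces.linear p"
      using plus scale by (intro linearI) (simp_all flip: scale_of_real)
    moreover have "continuous_on UNIV p"
      unfolding p_def using homeomorphism_cont2[OF g] by (rule continuous_on_fst)
    ultimately show ?thesis
      by (simp add: bounded_linear_if_continuous_at_0 continuous_on_eq_continuous_at)
  qed
  then have apply_p: "blinfun_apply (Blinfun p) = p"
    by (rule bounded_linear_Blinfun_apply)
  have p_A: "p a = a" if "a \<in> A" for a
    using p_add[of a 0] that sub by (simp add: subspace_0)
  have p_B: "p b = 0" if "b \<in> B" for b
    using p_add[of 0 b] that sub by (simp add: subspace_0)
  have "projection_onto_along s A B (Blinfun p)"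
    unfolding projection_onto_along_def op_range_def op_kernel_def apply_p
  proof (intro conjI)
    show "Blinfun p \<in> bounded_ops s s"
      using s by (simp add: bounded_ops_iff apply_p scale)
    show "Blinfun p o\<^sub>L Blinfun p = Blinfun p"
      by (rule blinfun_eqI) (simp add: apply_p p_A p)
    show "range p = A"
      using p p_A by (metis UNIV_I image_eqI image_subsetI subsetI subset_antisym)
    show "{x. p x = 0} = B"
      using p(2) p_B by (auto) (metis diff_zero)
  qed
  then show thesis by (rule that)
qed

lemma projection_absorbs:
  assumes "projection_onto_along s A B P" and "projection_onto_along s' A' B Q"
  shows "P (Q x) = P x"
proof -
  have "Q (x - Q x) = 0"
    using projection_in[OF assms(2)] projection_fixes[OF assms(2)] by (simp add: blinfun.diff_right)
  then have "P (x - Q x) = 0"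
    using projection_eq_0_iff[OF assms(1)] projection_eq_0_iff[OF assms(2)] by simp
  then show ?thesis by (simp add: blinfun.diff_right)
qed

text \<open>
  The description of \<^const>\<open>proj_along\<close> asks only for real linear projections.  The one found
  above is linear over all scalars, and it is the one described because range and kernel determine
  an idempotent.
\<close>

lemma projection_proj_along:
  assumes s: "banach_over s" and AB: "topological_direct_sum s A B"
  shows "projection_onto_along s A B (proj_along A B)"
proof -
  obtain P where P: "projection_onto_along s A B P"
    using topological_direct_sum_imp_projection[OF assms] .
  have "Q = P" if Q: "Q o\<^sub>L Q = Q" "op_range Q = A" "op_kernel Q = B" for Q
  proof (rule blinfun_eqI)
    fix x
    have "Q (P x) = P x"
      using Q projection_in[OF P, of x]
      by (auto simp: op_range_def) (metis blinfun_apply_blinfun_compose)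
    moreover have "x - P x \<in> B"
      using projection_eq_0_iff[OF P] projection_fixes[OF P projection_in[OF P]]
      by (simp flip: projection_eq_0_iff[OF P] add: blinfun.diff_right)
    then have "Q (x - P x) = 0"
      using Q by (auto simp: op_kernel_def)
    ultimately show "Q x = P x" by (simp add: blinfun.diff_right)
  qed
  then have "proj_along A B = P"
    unfolding proj_along_def using P by (intro the_equality) (auto simp: projection_onto_along_def)
  with P show ?thesis by simp
qed

lemma projection_onto_along_affine:
  assumes s: "banach_over s"
    and R: "projection_onto_along s A N R" and P: "projection_onto_along s A' N P"
  defines "Q \<equiv> \<lambda>t. (1 - t) *\<^sub>R R + t *\<^sub>R P"
  shows "projection_onto_along s (op_range (Q t)) N (Q t)"
proof -
  have Q: "Q t x = (1 - t) *\<^sub>R R x + t *\<^sub>R P x" for x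
    by (simp add: Q_def blinfun.add_left blinfun.scaleR_left)
  have RQ: "R (Q t x) = R x" and PQ: "P (Q t x) = P x" for x
    using projection_absorbs[OF R R] projection_absorbs[OF R P]
      projection_absorbs[OF P R] projection_absorbs[OF P P]
    by (simp_all add: Q blinfun.add_right blinfun.scaleR_right flip: scaleR_left_distrib)
  have "Q t x = 0 \<longleftrightarrow> x \<in> N" for x
  proof
    assume "Q t x = 0"
    with RQ[of x] show "x \<in> N" by (simp flip: projection_eq_0_iff[OF R])
  next
    assume "x \<in> N"
    then have "R x = 0" "P x = 0"
      by (simp_all only: projection_eq_0_iff[OF R] projection_eq_0_iff[OF P])
    then show "Q t x = 0"
      by (simp add: Q)
  qed
  moreover have "Q t o\<^sub>L Q t = Q t"
    by (rule blinfun_eqI) (simp add: Q[of "Q t _"] RQ PQ, simp add: Q)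
  moreover have "Q t \<in> bounded_ops s s"
    unfolding Q_def using R P s by (auto simp: projection_onto_along_def intro: bounded_ops_affine)
  ultimately show ?thesis
    by (auto simp: projection_onto_along_def op_kernel_def)
qed

text \<open>
  On the range of \<open>T\<close> the projection \<open>Q\<close> is injective, with inverse the restriction of \<open>R\<close>; and
  \<open>Q y = Q (R y)\<close> shows that \<open>Q\<close> already attains all its values there.
\<close>

lemma projection_comp_range_kernel:
  assumes R: "projection_onto_along s (op_range T) N R" and Q: "projection_onto_along s A N Q"
  shows "op_range (Q o\<^sub>L T) = A" and "op_kernel (Q o\<^sub>L T) = op_kernel T"
proof -
  have "Q y \<in> op_range (Q o\<^sub>L T)" for y
  proof -
    obtain x where "R y = T x"
      using projection_in[OF R, of y] by (auto simp: op_range_def)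
    then have "Q y = (Q o\<^sub>L T) x"
      using projection_absorbs[OF Q R, of y] by simp
    then show ?thesis by (auto simp: op_range_def)
  qed
  then show "op_range (Q o\<^sub>L T) = A"
    using projection_in[OF Q] projection_fixes[OF Q] by (auto simp: op_range_def) metis
  have "T x = 0" if "Q (T x) = 0" for x
  proof -
    have "R (T x) = 0"
      using that projection_eq_0_iff[OF Q] projection_eq_0_iff[OF R] by simp
    moreover have "R (T x) = T x"
      by (rule projection_fixes[OF R]) (simp add: op_range_def)
    ultimately show ?thesis by simp
  qed
  then show "op_kernel (Q o\<^sub>L T) = op_kernel T"
    by (auto simp: op_kernel_def)
qed

theorem theorem1p3:
  fixes sE :: "'k::real_normed_field \<Rightarrow> 'e::banach \<Rightarrow> 'e"
    and sF :: "'k \<Rightarrow> 'f::banach \<Rightarrow> 'f"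
    and T\<^sub>0 :: "'e \<Rightarrow>\<^sub>L 'f"
    and N F' :: "'f set"
  assumes "banach_over sE" and "banach_over sF"
    and "T\<^sub>0 \<in> double_splitting sE sF"
    and "topological_direct_sum sF (op_range T\<^sub>0) N"
    and "topological_direct_sum sF F' N"
    and "N \<noteq> {0}"
  shows "path_component
    {T \<in> double_splitting sE sF.
      topological_direct_sum sF (op_range T) N \<and> op_kernel T = op_kernel T\<^sub>0}
    T\<^sub>0 (proj_along F' N o\<^sub>L T\<^sub>0)"
proof -
  let ?S = "{T \<in> double_splitting sE sF.
      topological_direct_sum sF (op_range T) N \<and> op_kernel T = op_kernel T\<^sub>0}"
  define P where "P = proj_along F' N"
  have P: "projection_onto_along sF F' N P"
    unfolding P_def by (rule projection_proj_along) fact+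
  obtain R where R: "projection_onto_along sF (op_range T\<^sub>0) N R"
    using topological_direct_sum_imp_projection assms(2,4) by blast
  have "linepath T\<^sub>0 (P o\<^sub>L T\<^sub>0) t \<in> ?S" for t
  proof -
    define Q where "Q = (1 - t) *\<^sub>R R + t *\<^sub>R P"
    have Q: "projection_onto_along sF (op_range Q) N Q"
      unfolding Q_def by (rule projection_onto_along_affine[OF assms(2) R P])
    have line: "linepath T\<^sub>0 (P o\<^sub>L T\<^sub>0) t = Q o\<^sub>L T\<^sub>0"
    proof (rule blinfun_eqI)
      fix x
      have "R (T\<^sub>0 x) = T\<^sub>0 x"
        by (rule projection_fixes[OF R]) (simp add: op_range_def)
      then show "linepath T\<^sub>0 (P o\<^sub>L T\<^sub>0) t x = (Q o\<^sub>L T\<^sub>0) x"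
        by (simp add: linepath_def Q_def blinfun.add_left blinfun.scaleR_left)
    qed
    have "topological_direct_sum sF (op_range (Q o\<^sub>L T\<^sub>0)) N"
      using projection_imp_topological_direct_sum[OF assms(2) Q]
      by (simp add: projection_comp_range_kernel[OF R Q])
    moreover have "op_kernel (Q o\<^sub>L T\<^sub>0) = op_kernel T\<^sub>0"
      by (rule projection_comp_range_kernel[OF R Q])
    moreover have "Q o\<^sub>L T\<^sub>0 \<in> bounded_ops sE sF"
      using Q assms(1-3)
      by (auto simp: projection_onto_along_def double_splitting_def intro: bounded_ops_compose)
    ultimately show ?thesis
      using assms(3) unfolding line by (auto simp: double_splitting_def closed_complemented_def)
  qed
  then have "path_image (linepath T\<^sub>0 (P o\<^sub>L T\<^sub>0)) \<subseteq> ?S"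
    by (auto simp: path_image_def)
  then show ?thesis
    unfolding path_component_def P_def[symmetric]
    by (intro exI[of _ "linepath T\<^sub>0 (P o\<^sub>L T\<^sub>0)"]) simp
qed

end
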